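(* Let $n,t$ be positive integers with $t\ge 2$ and $n\ge \max\{t^3+4t^2+3t+4,\ \tfrac{17}{2}t^2+30t+27\}$. Let $g(n,t)=\left\lceil\frac{n+t}{2}\right\rceil \left\lfloor\frac{n-t}{2}\right\rfloor+tn+1$. (i) If $\lfloor (n-t)/2\rfloor$ is odd, then $ex(n,P_{t+1,2})=g(n,t)$. (ii) If $\lfloor (n-t)/2\rfloor$ is even, then $ex(n,P_{t+1,2})\in\{g(n,t)-1,\,g(n,t)\}$.
   Context: All digraphs are strict: no loops and no two parallel arcs (two arcs between the same pair of vertices in the same direction); arcs $uv$ and $vu$ may both be present. For a positive integer $k$, $P_{k,2}$ denotes the digraph consisting of $k$ directed paths of length 2 with the same initial vertex and the same terminal vertex (and otherwise disjoint), i.e. vertices $u,w,x_1,\dots,x_k$ (all distinct) with arcs $ux_i$ and $x_iw$ for $i=1,\dots,k$. A digraph is $P_{k,2}$-free if it contains no subdigraph isomorphic to $P_{k,2}$, i.e. there are no distinct vertices $u\neq w$ with $k$ distinct vertices $x$ (different from $u,w$) such that $ux$ and $xw$ are arcs. $ex(n,P_{k,2})$ is the maximum number of arcs of a $P_{k,2}$-free digraph on $n$ vertices. *)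

theory Defs
  imports Complex_Main
begin

text \<open>A (strict) digraph on the vertex set V: arc set A \<subseteq> V \<times> V without loops.
  Parallel arcs are impossible since A is a set; antiparallel arcs are allowed.\<close>
definition is_digraph :: "'a set \<Rightarrow> ('a \<times> 'a) set \<Rightarrow> bool" where
  "is_digraph V A \<longleftrightarrow> A \<subseteq> V \<times> V \<and> (\<forall>v. (v, v) \<notin> A)"

definition contains_Pk2 :: "nat \<Rightarrow> ('a \<times> 'a) set \<Rightarrow> bool" where
  "contains_Pk2 k A \<longleftrightarrow> (\<exists>u w X. u \<noteq> w \<and> card X = k \<and> finite X \<and> u \<notin> X \<and> w \<notin> X \<and>
      (\<forall>x\<in>X. (u, x) \<in> A \<and> (x, w) \<in> A))"

definition Pk2_free :: "nat \<Rightarrow> ('a \<times> 'a) set \<Rightarrow> bool" where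
  "Pk2_free k A \<longleftrightarrow> \<not> contains_Pk2 k A"

definition ex_Pk2 :: "nat \<Rightarrow> nat \<Rightarrow> nat" where
  "ex_Pk2 n k = Max {card A | A :: (nat \<times> nat) set. is_digraph {0..<n} A \<and> Pk2_free k A}"

end

theory Submission
  imports Defs
begin

text \<open>
  Upper bound: let \<open>u\<close> have maximal outdegree \<open>\<Delta>\<close>, \<open>N\<close> its out-neighbourhood and \<open>M\<close> the complement of \<open>N\<close>.
  Every \<open>w \<noteq> u\<close> has at most \<open>t\<close> in-neighbours in \<open>N\<close>, so a dense digraph has almost all outdegrees
  in \<open>M\<close> equal to \<open>\<Delta>\<close> and almost all these in-neighbour counts equal to \<open>t\<close>. Then all of \<open>M\<close> points
  to almost all of \<open>N\<close>; a common out-neighbour of \<open>M\<close> with \<open>t\<close> in-neighbours in \<open>N\<close> has indegree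
  at least \<open>n - \<Delta> + t\<close>. Hence the maximal out- or indegree is at least \<open>(n + t) / 2\<close>, and by
  reversing arcs we may assume the former. Now the count is at most \<open>\<Delta> (n - \<Delta>) + t (n - 1)\<close> plus the
  number of digons at \<open>u\<close>, and more than \<open>t + 1\<close> digons at each vertex of outdegree \<open>\<Delta>\<close> would
  force too many private digon partners inside \<open>M\<close>.

  Lower bound: take a complete digraph on \<open>t + 2\<close> core vertices, a set of sources dominating
  all but two core vertices, a set of sinks dominated by all but two other core vertices, all arcs
  from sources to sinks, a perfect matching of digons on either set, and a \<open>t\<close>-regular bipartite
  digraph from the sinks back to the sources. If a set has odd size, one of its vertices has no
  partner and is attached to a matched vertex instead.
\<close>

subsection \<open>Upper bound\<close>

lemma free_card_le:
  assumes "finite A" "is_digraph V A" "Pk2_free (Suc t) A" "u \<noteq> w"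
  shows "card {x. (u, x) \<in> A \<and> (x, w) \<in> A} \<le> t"
proof (rule ccontr)
  assume "\<not> ?thesis"
  then have "Suc t \<le> card {x. (u, x) \<in> A \<and> (x, w) \<in> A}" by simp
  then obtain X where X: "X \<subseteq> {x. (u, x) \<in> A \<and> (x, w) \<in> A}" "card X = Suc t" "finite X"
    by (rule obtain_subset_with_card_n)
  moreover have "(x, x) \<notin> A" for x using assms(2) by (auto simp: is_digraph_def)
  ultimately have "contains_Pk2 (Suc t) A"
    unfolding contains_Pk2_def using assms(4) by blast
  then show False using assms(3) by (simp add: Pk2_free_def)
qed

lemma sum_card_flip:
  assumes "finite X" "finite Y"
  shows "(\<Sum>x\<in>X. card (A `` {x} \<inter> Y)) = (\<Sum>y\<in>Y. card (A\<inverse> `` {y} \<inter> X))"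
proof -
  have "(\<Sum>x\<in>X. card (A `` {x} \<inter> Y)) = (\<Sum>x\<in>X. \<Sum>y\<in>Y. of_bool ((x, y) \<in> A))"
    using assms by (intro sum.cong refl) (auto simp: sum_of_bool_eq Int_def intro!: arg_cong[where f=card])
  also have "\<dots> = (\<Sum>y\<in>Y. \<Sum>x\<in>X. of_bool ((x, y) \<in> A))" by (rule sum.swap)
  also have "\<dots> = (\<Sum>y\<in>Y. card (A\<inverse> `` {y} \<inter> X))"
    using assms by (intro sum.cong refl) (auto simp: sum_of_bool_eq Int_def intro!: arg_cong[where f=card])
  finally show ?thesis .
qed

lemma card_pos_le_sum: "finite X \<Longrightarrow> card {x \<in> X. 0 < f x} \<le> sum f X" for f :: "'b \<Rightarrow> nat"
proof -
  assume X: "finite X"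
  have "card {x \<in> X. 0 < f x} = (\<Sum>x\<in>{x \<in> X. 0 < f x}. 1)" by simp
  also have "\<dots> \<le> (\<Sum>x\<in>{x \<in> X. 0 < f x}. f x)" by (intro sum_mono) auto
  also have "\<dots> \<le> sum f X" using X by (intro sum_mono2) auto
  finally show ?thesis .
qed

lemma finite_ne_max:
  fixes f :: "'b \<Rightarrow> nat"
  assumes "finite X" "X \<noteq> {}"
  obtains x where "x \<in> X" "\<And>y. y \<in> X \<Longrightarrow> f y \<le> f x"
  using Max_in[of "f ` X"] Max_ge[of "f ` X"] assms by (metis (no_types, lifting) finite_imageI image_iff image_is_empty imageI)

text \<open>Apart from \<open>uV\<close> and \<open>max\<close>, the assumptions are invariant under
  arc reversal and do not mention \<open>u\<close>. So the locale also applies to the reversed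
  digraph at a vertex of maximal indegree, and to any other vertex of maximal outdegree.
  \<open>dense\<close> bounds the arc count from below without floors or ceilings.\<close>

locale max_out =
  fixes V :: "'a set" and A :: "('a \<times> 'a) set" and t n :: nat and u :: 'a
  assumes fin: "finite V" and cardV: "card V = n"
    and sub: "A \<subseteq> V \<times> V" and irr: "(v, v) \<notin> A"
    and free: "x \<noteq> w \<Longrightarrow> card (A `` {x} \<inter> A\<inverse> `` {w}) \<le> t"
    and t2: "t \<ge> 2" and n_ge: "17 * t\<^sup>2 + 60 * t + 54 \<le> 2 * n"
    and dense: "n\<^sup>2 + 4 * t * n + 8 \<le> 4 * card A + (t + 1)\<^sup>2"
    and uV: "u \<in> V" and max: "v \<in> V \<Longrightarrow> card (A `` {v}) \<le> card (A `` {u})"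
begin

abbreviation "out v \<equiv> A `` {v}"
abbreviation "inn v \<equiv> A\<inverse> `` {v}"
abbreviation "N \<equiv> out u"
abbreviation "M \<equiv> V - out u"
abbreviation "\<Delta> \<equiv> card (out u)"
abbreviation "m \<equiv> card M"
abbreviation "\<delta> v \<equiv> \<Delta> - card (out v)"
abbreviation "\<gamma> w \<equiv> t - card (inn w \<inter> N)"
abbreviation "L \<equiv> card (out u \<inter> inn u)"

text \<open>The total defect: by \<open>count\<close>, the number of arcs falls short by exactly
  \<open>S\<close> of what \<Delta> and \<open>L\<close> allow.\<close>

definition "S = (\<Sum>v\<in>M. \<delta> v) + (\<Sum>w\<in>V - {u}. \<gamma> w)"

section \<open>The arc count around a vertex of maximal outdegree\<close>

lemma out_V: "out v \<subseteq> V" and inn_V: "inn v \<subseteq> V" using sub by auto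
lemma fin_out [simp, intro]: "finite (out v)" and fin_inn [simp, intro]: "finite (inn v)"
  using finite_subset[OF out_V fin] finite_subset[OF inn_V fin] by simp_all
lemma finM [simp, intro]: "finite M" using fin by simp
lemma uM: "u \<in> M" using uV irr by auto
lemma m_plus: "m + \<Delta> = n"
  using out_V[of u] fin cardV by (metis card_Diff_subset card_mono fin_out le_add_diff_inverse2)
lemma L_le: "L \<le> \<Delta>" by (simp add: card_mono)

lemma card_A: "card A = (\<Sum>v\<in>V. card (out v))"
proof -
  have "A = Sigma V out" using sub by auto
  moreover have "card (Sigma V out) = (\<Sum>v\<in>V. card (out v))" using fin by (simp add: card_SigmaI)
  ultimately show ?thesis by simp
qed

lemma sum_out: "finite X \<Longrightarrow> (\<Sum>x\<in>X. card (out x)) = (\<Sum>w\<in>V. card (inn w \<inter> X))"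
proof -
  assume "finite X"
  have "(\<Sum>x\<in>X. card (out x)) = (\<Sum>x\<in>X. card (out x \<inter> V))"
    using out_V by (simp add: Int_absorb2)
  then show ?thesis using sum_card_flip[OF \<open>finite X\<close> fin, of A] by simp
qed

lemma in_N_le: "w \<noteq> u \<Longrightarrow> card (inn w \<inter> N) \<le> t"
  using free[of u w] by (simp add: Int_commute)

text \<open>Arcs are split by tail. Tails in \<open>M\<close> give \<open>m * \<Delta>\<close> minus
  the \<delta> terms. Arcs leaving \<open>N\<close> are counted by head: \<open>u\<close> gives
  \<open>L\<close>, any other head gives \<open>t\<close> minus its \<gamma>.\<close>

lemma count: "card A + S = t * (n - 1) + L + m * \<Delta>"
proof -
  have "card A = (\<Sum>v\<in>N. card (out v)) + (\<Sum>v\<in>M. card (out v))"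
    unfolding card_A using fin out_V by (metis add.commute sum.subset_diff)
  moreover have "(\<Sum>v\<in>M. card (out v)) + (\<Sum>v\<in>M. \<delta> v) = m * \<Delta>"
    unfolding sum.distrib[symmetric] using max by simp
  moreover have "(\<Sum>v\<in>N. card (out v)) = L + (\<Sum>w\<in>V-{u}. card (inn w \<inter> N))"
    using sum_out[of N] uV fin by (simp add: sum.remove Int_commute)
  moreover have "(\<Sum>w\<in>V-{u}. card (inn w \<inter> N)) + (\<Sum>w\<in>V-{u}. \<gamma> w) = t * (n - 1)"
    unfolding sum.distrib[symmetric] using in_N_le uV fin cardV by simp
  ultimately show ?thesis by (simp add: S_def)
qed

lemma n_pos: "n \<ge> 121"
proof -
  have "17 * 2\<^sup>2 + 60 * 2 + 54 \<le> 17 * t\<^sup>2 + 60 * t + 54"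
    using t2 by (intro add_mono mult_mono power_mono) auto
  then show ?thesis using n_ge by simp
qed

lemma real_n_ge: "17 * (real t)\<^sup>2 + 60 * real t + 54 \<le> 2 * real n"
  using of_nat_mono[OF n_ge, where 'a = real] by simp

lemma real_m: "real m = real n - real \<Delta>" using m_plus by linarith

text \<open>Insert \<open>dense\<close> into \<open>count\<close> and write 4 \<Delta> (n -
  \<Delta>) as n^2 - (n - 2 \<Delta>)^2.\<close>

lemma S_le: "4 * real S \<le> 4 * real L - 8 + (real t - 1)\<^sup>2 - (real n - 2 * real \<Delta>)\<^sup>2"
proof -
  have "real (card A) + real S = real t * (real n - 1) + real L + (real n - real \<Delta>) * real \<Delta>"
    using arg_cong[OF count, of real] n_pos real_m by (simp add: of_nat_diff)
  moreover have "(real n)\<^sup>2 + 4 * real t * real n + 8 \<le> 4 * real (card A) + (real t + 1)\<^sup>2"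
    using of_nat_mono[OF dense, where 'a = real] by (simp add: algebra_simps)
  ultimately show ?thesis by (simp add: power2_eq_square algebra_simps)
qed

section \<open>Degree estimates, from crude to sharp\<close>

lemma S_nonneg: "0 \<le> real S" by simp

text \<open>Since \<open>S\<close> is nonnegative and L \<le> \<Delta>, \<open>S_le\<close> confines
  n - 2 \<Delta> to the order of the square root of n, which is at most n / 5 here.\<close>

lemma crude_range: "2 * real n \<le> 5 * real \<Delta>" "2 * real n \<le> 5 * real m"
proof -
  define d where "d = real \<Delta>" define N' where "N' = real n"
  have N1: "N' \<ge> 121" using n_pos by (simp add: N'_def)
  have NN: "N' * N' \<ge> 121 * N'" using N1 by (intro mult_right_mono) auto
  have tt: "(real t - 1)\<^sup>2 \<le> N'"
    using real_n_ge by (simp add: N'_def power2_eq_square algebra_simps)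
  have *: "(N' - 2 * d)\<^sup>2 \<le> 4 * d + N'"
    using S_le L_le tt S_nonneg unfolding d_def N'_def by linarith
  show "2 * real n \<le> 5 * real \<Delta>"
  proof (rule ccontr)
    assume "\<not> ?thesis"
    then have h: "5 * d < 2 * N'" by (simp add: d_def N'_def)
    then have "(N' / 5)\<^sup>2 \<le> (N' - 2 * d)\<^sup>2" using N1 by (intro power_mono) auto
    then have "(N' / 5)\<^sup>2 \<le> 4 * d + N'" using * by linarith
    then show False using h NN N1 by (simp add: power2_eq_square)
  qed
  show "2 * real n \<le> 5 * real m"
  proof (rule ccontr)
    assume "\<not> ?thesis"
    then have h: "3 * N' < 5 * d" using real_m by (simp add: d_def N'_def)
    \<comment> \<open>Moving the centre of the square by 1 absorbs the linear term
      \<open>4 * d\<close>.\<close>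
    have "(2 * d - N' - 1)\<^sup>2 \<le> 3 * N' + 1" using * by (simp add: power2_eq_square algebra_simps)
    moreover have "(N' / 5 - 1)\<^sup>2 \<le> (2 * d - N' - 1)\<^sup>2" using N1 h by (intro power_mono) auto
    ultimately have "(N' / 5 - 1)\<^sup>2 \<le> 3 * N' + 1" by linarith
    then show False using NN N1 by (simp add: power2_eq_square algebra_simps)
  qed
qed

abbreviation "dM v \<equiv> card (out v \<inter> M)"
abbreviation "dN v \<equiv> card (out v \<inter> N)"

lemma dM_dN: "dM v + dN v = card (out v)"
proof -
  have "out v = (out v \<inter> M) \<union> (out v \<inter> N)" using out_V by auto
  then show ?thesis by (metis (no_types, lifting) Diff_disjoint Int_Diff card_Un_disjoint fin_out finite_Int
      inf.assoc inf.commute inf_bot_right)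
qed

lemma miss: "v \<in> V \<Longrightarrow> card (N - out v) = dM v + \<delta> v"
proof -
  assume "v \<in> V"
  have "card (N - out v) + dN v = \<Delta>"
    using card_Diff_subset_Int[of N "out v"] card_mono[of N "out v \<inter> N"] by (simp add: Int_commute)
  then show ?thesis using dM_dN[of v] max[OF \<open>v \<in> V\<close>] by linarith
qed

lemma delta_sum_le: "X \<subseteq> M \<Longrightarrow> (\<Sum>v\<in>X. \<delta> v) \<le> S"
  unfolding S_def by (meson finM sum_mono2 trans_le_add1 zero_le)

text \<open>Count the walks of length two from \<open>v\<close>: at most \<open>t\<close> end in
  each other vertex and at most \<Delta> return. But out-neighbours in \<open>M\<close> have
  outdegree \<Delta>, up to a total defect \<open>S\<close>, so there can be only about t n /
  \<Delta> of them.\<close>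

lemma dM_crude: "v \<in> M \<Longrightarrow> 2 * dM v \<le> 5 * t + 5"
proof -
  assume v: "v \<in> M"
  have "(\<Sum>x\<in>out v. card (out x)) = (\<Sum>w\<in>V. card (inn w \<inter> out v))"
    by (rule sum_out) simp
  also have "\<dots> = card (inn v \<inter> out v) + (\<Sum>w\<in>V-{v}. card (inn w \<inter> out v))"
    using v by (intro sum.remove[OF fin]) auto
  also have "\<dots> \<le> \<Delta> + (\<Sum>w\<in>V-{v}. t)"
  proof (intro add_mono sum_mono)
    show "card (inn v \<inter> out v) \<le> \<Delta>"
      using v max[of v] card_mono[of "out v" "inn v \<inter> out v"] by auto
    fix w assume "w \<in> V - {v}"
    then show "card (inn w \<inter> out v) \<le> t" using free[of v w] by (auto simp: Int_commute)
  qed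
  also have "\<dots> \<le> \<Delta> + t * n" using v fin cardV by simp
  finally have 1: "(\<Sum>x\<in>out v. card (out x)) \<le> \<Delta> + t * n" .
  have "dM v * \<Delta> = (\<Sum>x\<in>out v \<inter> M. card (out x)) + (\<Sum>x\<in>out v \<inter> M. \<delta> x)"
    unfolding sum.distrib[symmetric] using max by simp
  also have "\<dots> \<le> (\<Sum>x\<in>out v. card (out x)) + S"
    by (intro add_mono sum_mono2 delta_sum_le) auto
  finally have "dM v * \<Delta> \<le> \<Delta> + t * n + S" using 1 by linarith
  from of_nat_mono[OF this, where 'a = real]
  have "real (dM v) * real \<Delta> \<le> real \<Delta> + real t * real n + real S" by simp
  moreover have "4 * real S \<le> 4 * real \<Delta> + (real t - 1)\<^sup>2"
    using S_le L_le zero_le_power2[of "real n - 2 * real \<Delta>"] by linarith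
  moreover have "(real t - 1)\<^sup>2 \<le> 2 * real \<Delta>"
    using real_n_ge crude_range(1) t2 unfolding power2_eq_square by (simp add: algebra_simps)
  moreover have "real t * real n \<le> real t * (5 / 2 * real \<Delta>)"
    using crude_range(1) by (intro mult_left_mono) auto
  ultimately have "real (dM v) * real \<Delta> \<le> (5 / 2 * real t + 5 / 2) * real \<Delta>"
    by (simp add: algebra_simps)
  moreover have "real \<Delta> > 0" using crude_range(1) n_pos by linarith
  ultimately have "real (dM v) \<le> 5 / 2 * real t + 5 / 2" by simp
  then show ?thesis by linarith
qed

text \<open>Otherwise the \<delta> terms alone would exceed \<open>S\<close>. The vertex must differ
  from \<open>u\<close>, because paths from it to \<open>u\<close> are going to be counted.\<close>

lemma ex_small_delta: "\<exists>v\<in>M - {u}. \<delta> v \<le> 1"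
proof (rule ccontr)
  assume no: "\<not> ?thesis"
  have "(\<Sum>v\<in>M-{u}. 2) \<le> (\<Sum>v\<in>M-{u}. \<delta> v)"
  proof (rule sum_mono)
    fix v assume "v \<in> M - {u}"
    with no have "\<not> \<delta> v \<le> 1" by blast
    then show "2 \<le> \<delta> v" by linarith
  qed
  also have "\<dots> \<le> S" by (rule delta_sum_le) auto
  finally have "2 * (m - 1) \<le> S" using uM by simp
  then have "2 * m \<le> S + 2" by linarith
  then have "2 * real m \<le> real S + 2" by linarith
  moreover have "4 * real S \<le> 4 * real \<Delta> + (real t - 1)\<^sup>2 - 8"
    using S_le L_le zero_le_power2[of "real n - 2 * real \<Delta>"] by linarith
  moreover have "17 * (real t - 1)\<^sup>2 \<le> 2 * real n"
    using real_n_ge t2 unfolding power2_eq_square by (simp add: algebra_simps)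
  ultimately show False using crude_range real_m n_pos by linarith
qed

text \<open>Take \<open>v\<close> from \<open>ex_small_delta\<close>. A digon partner of
  \<open>u\<close> is either the middle of a path from \<open>v\<close> to \<open>u\<close>, or one
  of the few vertices of \<open>N\<close> that \<open>v\<close> misses.\<close>

lemma L_le_crude: "2 * L \<le> 7 * t + 7"
proof -
  obtain v where v: "v \<in> M" "v \<noteq> u" "\<delta> v \<le> 1" using ex_small_delta by auto
  have "L \<le> card ((out v \<inter> inn u) \<union> (N - out v))" by (intro card_mono) auto
  also have "\<dots> \<le> card (out v \<inter> inn u) + card (N - out v)" by (rule card_Un_le)
  also have "\<dots> \<le> t + (dM v + \<delta> v)" using free[OF v(2)] miss[of v] v(1) by auto
  finally show ?thesis using dM_crude[OF v(1)] v(3) by linarith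
qed

text \<open>Now that \<open>L\<close> is linear in \<open>t\<close>, \<open>S_le\<close> bounds both
  the defect and the imbalance n - 2 \<Delta> in terms of \<open>t\<close> alone.\<close>

lemma S_le2: "4 * real S \<le> (real t)\<^sup>2 + 12 * real t + 7"
  and range: "real n - real t - 6 \<le> 2 * real \<Delta>" "real n - real t - 6 \<le> 2 * real m"
proof -
  have L: "2 * real L \<le> 7 * real t + 7" using L_le_crude by linarith
  have *: "4 * real S + (real n - 2 * real \<Delta>)\<^sup>2 \<le> (real t)\<^sup>2 + 12 * real t + 7"
    using S_le L by (simp add: power2_eq_square algebra_simps)
  show "4 * real S \<le> (real t)\<^sup>2 + 12 * real t + 7"
    using * zero_le_power2[of "real n - 2 * real \<Delta>"] by linarith
  have "(real n - 2 * real \<Delta>)\<^sup>2 \<le> (real t + 6)\<^sup>2" using * by (simp add: power2_eq_square algebra_simps)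
  then have "\<bar>real n - 2 * real \<Delta>\<bar> \<le> real t + 6" 
    using abs_le_square_iff[of "real n - 2 * real \<Delta>" "real t + 6"] by simp
  then show "real n - real t - 6 \<le> 2 * real \<Delta>" "real n - real t - 6 \<le> 2 * real m"
    using real_m by linarith+
qed

lemma Delta_ge: "17 * (real t)\<^sup>2 + 58 * real t + 42 \<le> 4 * real \<Delta>"
  and m_ge: "17 * (real t)\<^sup>2 + 58 * real t + 42 \<le> 4 * real m"
  using range real_n_ge by linarith+

text \<open>Seen from a head \<open>w\<close> in \<open>N\<close>, the tails counted are middles of
  paths from \<open>v\<close> to \<open>w\<close>.\<close>

lemma sum_dN_out: "v \<in> M \<Longrightarrow> (\<Sum>x\<in>out v \<inter> M. dN x) \<le> t * \<Delta>"
proof -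
  assume v: "v \<in> M"
  have "(\<Sum>x\<in>out v \<inter> M. dN x) = (\<Sum>w\<in>N. card (inn w \<inter> (out v \<inter> M)))"
    by (rule sum_card_flip) auto
  also have "\<dots> \<le> (\<Sum>w\<in>N. t)"
  proof (rule sum_mono)
    fix w assume "w \<in> N"
    then have "v \<noteq> w" using v by auto
    have "card (inn w \<inter> (out v \<inter> M)) \<le> card (out v \<inter> inn w)" by (intro card_mono) auto
    then show "card (inn w \<inter> (out v \<inter> M)) \<le> t" using free[OF \<open>v \<noteq> w\<close>] by linarith
  qed
  finally show ?thesis by (simp add: mult.commute)
qed

text \<open>By \<open>dM_crude\<close>, an out-neighbour in \<open>M\<close> sends nearly \<Delta>
  arcs into \<open>N\<close>; \<open>t + 1\<close> of them would exceed the total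
  \<open>t * \<Delta>\<close> of \<open>sum_dN_out\<close>.\<close>

lemma dM_le: "v \<in> M \<Longrightarrow> dM v \<le> t"
proof (rule ccontr)
  assume v: "v \<in> M" and "\<not> dM v \<le> t"
  then have big: "real t + 1 \<le> real (dM v)" by linarith
  have "real (dM v) * (real \<Delta> - (5 / 2 * real t + 5 / 2)) = (\<Sum>x\<in>out v \<inter> M. real \<Delta> - (5 / 2 * real t + 5 / 2))"
    by simp
  also have "\<dots> \<le> (\<Sum>x\<in>out v \<inter> M. real (dN x) + real (\<delta> x))"
  proof (rule sum_mono)
    fix x assume "x \<in> out v \<inter> M"
    then have "2 * dM x \<le> 5 * t + 5" "card (out x) \<le> \<Delta>" using dM_crude max by auto
    then show "real \<Delta> - (5 / 2 * real t + 5 / 2) \<le> real (dN x) + real (\<delta> x)"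
      using dM_dN[of x] by linarith
  qed
  also have "\<dots> = real ((\<Sum>x\<in>out v \<inter> M. dN x) + (\<Sum>x\<in>out v \<inter> M. \<delta> x))" by (simp add: sum.distrib)
  also have "\<dots> \<le> real (t * \<Delta> + S)"
    by (intro of_nat_mono add_mono sum_dN_out delta_sum_le v) auto
  finally have "real (dM v) * (real \<Delta> - (5 / 2 * real t + 5 / 2)) \<le> real t * real \<Delta> + real S" by simp
  moreover have "(real t + 1) * (real \<Delta> - (5 / 2 * real t + 5 / 2)) \<le> real (dM v) * (real \<Delta> - (5 / 2 * real t + 5 / 2))"
  proof (rule mult_right_mono[OF big])
    have "(real t)\<^sup>2 \<ge> 0" "real t \<ge> 0" by auto
    then show "0 \<le> real \<Delta> - (5 / 2 * real t + 5 / 2)" using Delta_ge by linarith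
  qed
  ultimately have "(real t + 1) * (real \<Delta> - (5 / 2 * real t + 5 / 2)) \<le> real t * real \<Delta> + real S" by linarith
  then have "real \<Delta> \<le> real S + 5 / 2 * (real t + 1)\<^sup>2" by (simp add: power2_eq_square field_simps)
  then have "4 * real \<Delta> \<le> 11 * (real t)\<^sup>2 + 32 * real t + 17"
    using S_le2 by (simp add: power2_eq_square algebra_simps)
  moreover have "(real t)\<^sup>2 \<ge> 0" "real t \<ge> 0" by auto
  ultimately show False using Delta_ge by linarith
qed

section \<open>Vertices of \<open>N\<close> dominated by all of \<open>M\<close>\<close>

definition "Z = {z \<in> N. \<Delta> \<le> 2 * dN z}"

lemma Z_N: "Z \<subseteq> N" by (auto simp: Z_def)
lemma finZ [simp]: "finite Z" using Z_N fin_out finite_subset by blast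

lemma Delta_pos: "real \<Delta> > 0" using crude_range(1) n_pos by linarith

text \<open>Each vertex of \<open>N\<close> has at most \<open>t\<close> in-neighbours in
  \<open>N\<close>, so \<open>N\<close> spans at most \<open>t * \<Delta>\<close> arcs, and few of
  its vertices can dominate half of it.\<close>

lemma card_Z: "card Z \<le> 2 * t"
proof -
  have "card Z * \<Delta> = (\<Sum>z\<in>Z. \<Delta>)" by simp
  also have "\<dots> \<le> (\<Sum>z\<in>Z. 2 * dN z)" by (intro sum_mono) (auto simp: Z_def)
  also have "\<dots> \<le> (\<Sum>z\<in>N. 2 * dN z)" using Z_N by (intro sum_mono2) auto
  also have "\<dots> = 2 * (\<Sum>z\<in>N. dN z)" by (simp only: sum_distrib_left)
  also have "\<dots> = 2 * (\<Sum>w\<in>N. card (inn w \<inter> N))" using sum_card_flip[of N N A] by simp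
  also have "\<dots> \<le> 2 * (\<Sum>w\<in>N. t)"
    using irr by (intro mult_left_mono sum_mono in_N_le) auto
  also have "\<dots> = 2 * t * \<Delta>" by simp
  finally show ?thesis using Delta_pos by simp
qed

text \<open>If \<open>v\<close> skips some of \<open>N\<close> in favour of out-neighbours in \<open>M\<close>, then those out-neighbours
  already provide paths to almost all of \<open>N\<close>, so what is skipped must dominate almost all of \<open>N\<close>.\<close>
lemma miss_outside_Z: "v \<in> M \<Longrightarrow> card (N - out v - Z) \<le> 2 * \<delta> v"
proof -
  assume v: "v \<in> M"
  define Q where "Q = N - out v"
  have finQ: "finite Q" by (simp add: Q_def)
  have cQ: "card Q = dM v + \<delta> v" using miss v by (simp add: Q_def)
  \<comment> \<open>At most \<open>t\<close> paths lead from \<open>v\<close> to \<open>w\<close>,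
    while \<open>w\<close> has \<open>t - \<gamma> w\<close> in-neighbours in \<open>N\<close>. So
    each out-neighbour of \<open>v\<close> in \<open>M\<close> that points to \<open>w\<close> is
    paid for by an in-neighbour of \<open>w\<close> in \<open>Q\<close> or by
    \<open>\<gamma> w\<close>.\<close>
  have "dM v \<le> card (inn w \<inter> Q) + \<gamma> w + card ((out v \<inter> M) - inn w)" if w: "w \<in> N" for w
  proof -
    have "v \<noteq> w" "w \<noteq> u" using v w irr by auto
    have "dM v = card (out v \<inter> M \<inter> inn w) + card ((out v \<inter> M) - inn w)"
      using card_Int_Diff[of "out v \<inter> M" "inn w"] by simp
    moreover have "card (out v \<inter> inn w) = card (out v \<inter> M \<inter> inn w) + card (out v \<inter> N \<inter> inn w)"
    proof -
      have eq: "out v \<inter> inn w = (out v \<inter> M \<inter> inn w) \<union> (out v \<inter> N \<inter> inn w)" using out_V by auto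
      show ?thesis by (subst eq) (rule card_Un_disjoint; auto)
    qed
    moreover have "card (inn w \<inter> N) = card (out v \<inter> N \<inter> inn w) + card (inn w \<inter> Q)"
    proof -
      have "inn w \<inter> N \<inter> out v = out v \<inter> N \<inter> inn w" "(inn w \<inter> N) - out v = inn w \<inter> Q"
        by (auto simp: Q_def)
      then show ?thesis using card_Int_Diff[of "inn w \<inter> N" "out v"] by simp
    qed
    ultimately show ?thesis using free[OF \<open>v \<noteq> w\<close>] in_N_le[OF \<open>w \<noteq> u\<close>] by linarith
  qed
  then have "(\<Sum>w\<in>N. dM v) \<le> (\<Sum>w\<in>N. card (inn w \<inter> Q) + \<gamma> w + card ((out v \<inter> M) - inn w))"
    by (rule sum_mono)
  then have 1: "dM v * \<Delta> \<le> (\<Sum>w\<in>N. card (inn w \<inter> Q)) + (\<Sum>w\<in>N. \<gamma> w) + (\<Sum>w\<in>N. card ((out v \<inter> M) - inn w))"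
    by (simp add: sum.distrib mult.commute)
  \<comment> \<open>Double counting of non-arcs, with the complement relation
    \<open>- A\<close>.\<close>
  have "(\<Sum>w\<in>N. card ((out v \<inter> M) - inn w)) = (\<Sum>w\<in>N. card ((- A)\<inverse> `` {w} \<inter> (out v \<inter> M)))"
    by (intro sum.cong arg_cong[where f = card]) auto
  also have "\<dots> = (\<Sum>x\<in>out v \<inter> M. card ((- A) `` {x} \<inter> N))"
    by (rule sum_card_flip[symmetric]) auto
  also have "\<dots> = (\<Sum>x\<in>out v \<inter> M. card (N - out x))"
    by (intro sum.cong arg_cong[where f = card]) auto
  also have "\<dots> = (\<Sum>x\<in>out v \<inter> M. dM x + \<delta> x)" by (intro sum.cong miss) auto
  also have "\<dots> \<le> (\<Sum>x\<in>out v \<inter> M. t) + (\<Sum>x\<in>M. \<delta> x)"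
    unfolding sum.distrib by (intro add_mono sum_mono sum_mono2 dM_le) auto
  also have "\<dots> \<le> t * t + (\<Sum>x\<in>M. \<delta> x)" using dM_le[OF v] by simp
  finally have 2: "(\<Sum>w\<in>N. card ((out v \<inter> M) - inn w)) \<le> t * t + (\<Sum>x\<in>M. \<delta> x)" .
  have 3: "(\<Sum>w\<in>N. \<gamma> w) \<le> (\<Sum>w\<in>V-{u}. \<gamma> w)"
    using out_V irr fin by (intro sum_mono2) auto
  have "2 * (\<Sum>w\<in>N. card (inn w \<inter> Q)) = (\<Sum>q\<in>Q. 2 * dN q)"
    unfolding sum_distrib_left[symmetric] using sum_card_flip[OF finQ, of N A] by simp
  also have "\<dots> = (\<Sum>q\<in>Q \<inter> Z. 2 * dN q) + (\<Sum>q\<in>Q - Z. 2 * dN q)"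
    using finQ by (rule sum.Int_Diff)
  also have "\<dots> \<le> (\<Sum>q\<in>Q \<inter> Z. 2 * \<Delta>) + (\<Sum>q\<in>Q - Z. \<Delta>)"
  proof (intro add_mono sum_mono)
    fix q show "2 * dN q \<le> 2 * \<Delta>" by (simp add: card_mono)
  next
    fix q assume "q \<in> Q - Z" then show "2 * dN q \<le> \<Delta>" by (auto simp: Q_def Z_def)
  qed
  finally have 4: "2 * (\<Sum>w\<in>N. card (inn w \<inter> Q)) \<le> 2 * (card (Q \<inter> Z) * \<Delta>) + card (Q - Z) * \<Delta>" by simp
  have 5: "card (Q \<inter> Z) + card (Q - Z) = dM v + \<delta> v"
    using card_Int_Diff[OF finQ, of Z] cQ by simp
  \<comment> \<open>A vertex of \<open>Q\<close> outside \<open>Z\<close> pays at most half of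
    \<Delta>. As \<open>Q\<close> has only \<open>dM v + \<delta> v\<close> vertices, each such
    vertex costs \<Delta> / 2, covered by \<open>\<delta> v * \<Delta>\<close> and an error whose
    double is below \<Delta>.\<close>
  have "2 * (dM v * \<Delta>) \<le> 2 * (card (Q \<inter> Z) * \<Delta>) + card (Q - Z) * \<Delta> + 2 * (t * t) + 2 * S"
    using 1 2 3 4 S_def by linarith
  from of_nat_mono[OF this, where 'a = real]
  have "2 * (real (dM v) * real \<Delta>) \<le> 2 * real (card (Q \<inter> Z)) * real \<Delta> + real (card (Q - Z)) * real \<Delta> + 2 * (real t * real t + real S)"
    by simp
  moreover have "real (card (Q \<inter> Z)) = real (dM v) + real (\<delta> v) - real (card (Q - Z))"
    using 5 by linarith
  ultimately have 6: "real (card (Q - Z)) * real \<Delta> \<le> 2 * real (\<delta> v) * real \<Delta> + 2 * (real t)\<^sup>2 + 2 * real S"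
    by (simp add: power2_eq_square algebra_simps)
  have "(real t)\<^sup>2 \<ge> 0" "real t \<ge> 0" by auto
  then have "2 * (real t)\<^sup>2 + 2 * real S < real \<Delta>" using S_le2 Delta_ge by linarith
  then have "real (card (Q - Z)) * real \<Delta> < (2 * real (\<delta> v) + 1) * real \<Delta>"
    using 6 by (simp add: algebra_simps)
  then have "real (card (Q - Z)) < 2 * real (\<delta> v) + 1" using Delta_pos mult_less_cancel_right_pos by blast
  then show ?thesis unfolding Q_def by linarith
qed

text \<open>A vertex of \<open>N - Z\<close> that fails has positive \<gamma> or is skipped by some
  vertex of \<open>M\<close>. By \<open>miss_outside_Z\<close> at most \<open>2 * S\<close> vertices
  fail, fewer than \<open>N - Z\<close> has.\<close>

lemma ex_full_vertex: "\<exists>w\<in>N - Z. card (inn w \<inter> N) = t \<and> M \<subseteq> inn w"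
proof (rule ccontr)
  assume no: "\<not> ?thesis"
  have "N - Z \<subseteq> {w \<in> V - {u}. 0 < \<gamma> w} \<union> (\<Union>v\<in>M. N - out v - Z)"
  proof
    fix w assume w: "w \<in> N - Z"
    then have "w \<in> V" "w \<noteq> u" using sub irr by auto
    from no w have "card (inn w \<inter> N) \<noteq> t \<or> \<not> M \<subseteq> inn w" by blast
    then show "w \<in> {w \<in> V - {u}. 0 < \<gamma> w} \<union> (\<Union>v\<in>M. N - out v - Z)"
      using w in_N_le[OF \<open>w \<noteq> u\<close>] \<open>w \<in> V\<close> \<open>w \<noteq> u\<close> by auto
  qed
  then have "card (N - Z) \<le> card ({w \<in> V - {u}. 0 < \<gamma> w} \<union> (\<Union>v\<in>M. N - out v - Z))"
    using fin by (intro card_mono) auto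
  also have "\<dots> \<le> card {w \<in> V - {u}. 0 < \<gamma> w} + card (\<Union>v\<in>M. N - out v - Z)" by (rule card_Un_le)
  also have "\<dots> \<le> (\<Sum>w\<in>V-{u}. \<gamma> w) + (\<Sum>v\<in>M. 2 * \<delta> v)"
  proof (rule add_mono)
    show "card {w \<in> V - {u}. 0 < \<gamma> w} \<le> (\<Sum>w\<in>V-{u}. \<gamma> w)"
      using fin by (intro card_pos_le_sum) auto
    have "card (\<Union>v\<in>M. N - out v - Z) \<le> (\<Sum>v\<in>M. card (N - out v - Z))" by (rule card_UN_le) simp
    also have "\<dots> \<le> (\<Sum>v\<in>M. 2 * \<delta> v)" by (intro sum_mono miss_outside_Z)
    finally show "card (\<Union>v\<in>M. N - out v - Z) \<le> (\<Sum>v\<in>M. 2 * \<delta> v)" .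
  qed
  also have "\<dots> \<le> 2 * S" unfolding S_def sum_distrib_left[symmetric] by simp
  finally have "card (N - Z) \<le> 2 * S" .
  moreover have "card N \<le> card (N - Z) + card Z" using Z_N by (simp add: card_Diff_subset)
  ultimately have "real \<Delta> \<le> 2 * real S + 2 * real t" using card_Z by linarith
  moreover have "(real t)\<^sup>2 \<ge> 0" "real t \<ge> 0" by auto
  ultimately show False using S_le2 Delta_ge by linarith
qed

text \<open>The vertex of \<open>ex_full_vertex\<close> receives arcs from all of \<open>M\<close>
  and from \<open>t\<close> vertices of \<open>N\<close>.\<close>

lemma ex_large_indegree: "\<exists>w\<in>V. n + t \<le> card (inn w) + \<Delta>"
proof -
  obtain w where w: "w \<in> N - Z" "card (inn w \<inter> N) = t" "M \<subseteq> inn w" using ex_full_vertex by auto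
  have "card (M \<union> (inn w \<inter> N)) = m + t" using w(2) by (subst card_Un_disjoint) auto
  moreover have "card (M \<union> (inn w \<inter> N)) \<le> card (inn w)" using w(3) by (intro card_mono) auto
  ultimately show ?thesis using m_plus w(1) sub by (intro bexI[of _ w]) auto
qed

section \<open>Too many digons at vertices of maximal outdegree\<close>

lemma S_le_digons:
  assumes "m * \<Delta> + t * n + 2 \<le> card A"
  shows "S + t + 2 \<le> L"
proof -
  have "t * n = t * (n - 1) + t" using n_pos by (cases n) auto
  then show ?thesis using count assms by linarith
qed

text \<open>Any vertex of maximal outdegree can take the role of \<open>u\<close>, with the same
  \<open>m\<close> and \<Delta>.\<close>

lemma S_le_digons_max:
  assumes "m * \<Delta> + t * n + 2 \<le> card A" and v: "v \<in> V" "card (out v) = \<Delta>"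
  shows "t + 2 \<le> card (out v \<inter> inn v)"
proof -
  interpret v: max_out V A t n v
    using fin cardV sub irr free t2 n_ge dense v max by unfold_locales auto
  have "card (V - out v) = m" using v.m_plus m_plus v(2) by linarith
  then show ?thesis using v.S_le_digons assms(1) v(2) by simp
qed

text \<open>A vertex \<open>v\<close> of \<open>G\<close> already receives \<open>t\<close> paths through \<open>N - Z\<close> from every other vertex
  of maximal outdegree in \<open>M\<close>. So its at least two digon partners in \<open>M\<close> belong to it alone,
  and there is no room for them in \<open>M\<close>.\<close>
lemma not_too_dense:
  assumes strong: "m * \<Delta> + t * n + 2 \<le> card A"
  shows False
proof -
  define Mx where "Mx = {v \<in> M. \<delta> v = 0}"
  define G where "G = {v \<in> Mx - {u}. \<gamma> v = 0 \<and> inn v \<inter> Z = {}}"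
  define Y where "Y v = out v \<inter> inn v \<inter> M" for v
  obtain w0 where w0: "w0 \<in> N - Z" "M \<subseteq> inn w0" using ex_full_vertex by auto
  \<comment> \<open>All of \<open>M\<close> points to \<open>w0\<close>, so out-neighbours of
    \<open>z\<close> in \<open>M\<close> are middles of paths from \<open>z\<close> to
    \<open>w0\<close>. Hence excluding the out-neighbours of \<open>Z\<close> from \<open>G\<close>
    costs at most \<open>2 * t * t\<close> vertices.\<close>
  have ZM: "card (out z \<inter> M) \<le> t" if "z \<in> Z" for z
  proof -
    have "z \<noteq> w0" using that w0 by auto
    have "card (out z \<inter> M) \<le> card (out z \<inter> inn w0)" using w0 by (intro card_mono) auto
    then show ?thesis using free[OF \<open>z \<noteq> w0\<close>] by linarith
  qed
  have max_full: "N - Z \<subseteq> out v" if "v \<in> Mx" for v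
  proof -
    have "v \<in> M" "\<delta> v = 0" using that unfolding Mx_def by blast+
    then have "card (N - out v - Z) = 0" using miss_outside_Z[of v] by linarith
    then show ?thesis by auto
  qed
  have G_in: "card (inn v \<inter> (N - Z)) = t" if "v \<in> G" for v
  proof -
    have "v \<noteq> u" "\<gamma> v = 0" "inn v \<inter> Z = {}" using that unfolding G_def by blast+
    then have "card (inn v \<inter> N) = t" using in_N_le[of v] by linarith
    moreover have "inn v \<inter> N = inn v \<inter> (N - Z)" using \<open>inn v \<inter> Z = {}\<close> by auto
    ultimately show ?thesis by simp
  qed
  have other: "out v' \<inter> inn v \<inter> M = {}" if "v \<in> G" "v' \<in> Mx" "v' \<noteq> v" for v v'
  proof -
    have "inn v \<inter> (N - Z) \<subseteq> out v' \<inter> inn v" using max_full[OF that(2)] by auto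
    moreover have "card (out v' \<inter> inn v) \<le> card (inn v \<inter> (N - Z))"
      using free[OF that(3)] G_in[OF that(1)] by simp
    ultimately have "inn v \<inter> (N - Z) = out v' \<inter> inn v" by (intro card_seteq) auto
    then show ?thesis by auto
  qed
  have Y2: "2 \<le> card (Y v)" if "v \<in> G" for v
  proof -
    have v: "v \<in> V" "v \<noteq> u" "card (out v) = \<Delta>"
      using that max[of v] unfolding G_def Mx_def by auto
    have "card (out v \<inter> inn v) \<le> card (Y v \<union> (inn v \<inter> N))"
      using out_V by (intro card_mono) (auto simp: Y_def)
    also have "\<dots> \<le> card (Y v) + card (inn v \<inter> N)" by (rule card_Un_le)
    finally show ?thesis using S_le_digons_max[OF strong v(1,3)] in_N_le[OF v(2)] by linarith
  qed
  have GM: "G \<subseteq> M" "G \<subseteq> Mx" by (auto simp: G_def Mx_def)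
  then have finG: "finite G" using finM finite_subset by blast
  have "2 * card G = (\<Sum>v\<in>G. 2)" by simp
  also have "\<dots> \<le> (\<Sum>v\<in>G. card (Y v))" by (intro sum_mono Y2)
  also have "\<dots> = card (\<Union>v\<in>G. Y v)"
  proof (rule card_UN_disjoint[symmetric])
    show "\<forall>v\<in>G. \<forall>v'\<in>G. v \<noteq> v' \<longrightarrow> Y v \<inter> Y v' = {}"
      using other GM unfolding Y_def by blast
  qed (auto simp: finG Y_def)
  also have "\<dots> \<le> m" by (intro card_mono) (auto simp: Y_def)
  finally have G1: "2 * card G \<le> m" .
  have "M \<subseteq> G \<union> {u} \<union> {v \<in> M. 0 < \<delta> v} \<union> {v \<in> V - {u}. 0 < \<gamma> v} \<union> (\<Union>z\<in>Z. out z \<inter> M)"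
    by (auto simp: G_def Mx_def)
  then have "m \<le> card (G \<union> {u} \<union> {v \<in> M. 0 < \<delta> v} \<union> {v \<in> V - {u}. 0 < \<gamma> v} \<union> (\<Union>z\<in>Z. out z \<inter> M))"
    using finG fin by (intro card_mono) auto
  also have "\<dots> \<le> card G + 1 + card {v \<in> M. 0 < \<delta> v} + card {v \<in> V - {u}. 0 < \<gamma> v} + card (\<Union>z\<in>Z. out z \<inter> M)"
    by (intro order_trans[OF card_Un_le] add_mono) auto
  also have "\<dots> \<le> card G + 1 + (\<Sum>v\<in>M. \<delta> v) + (\<Sum>v\<in>V - {u}. \<gamma> v) + 2 * t * t"
  proof (intro add_mono order_refl)
    show "card {v \<in> M. 0 < \<delta> v} \<le> (\<Sum>v\<in>M. \<delta> v)" by (rule card_pos_le_sum) auto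
    show "card {v \<in> V - {u}. 0 < \<gamma> v} \<le> (\<Sum>v\<in>V - {u}. \<gamma> v)" using fin by (intro card_pos_le_sum) auto
    have "card (\<Union>z\<in>Z. out z \<inter> M) \<le> (\<Sum>z\<in>Z. card (out z \<inter> M))" by (rule card_UN_le) simp
    also have "\<dots> \<le> (\<Sum>z\<in>Z. t)" by (intro sum_mono ZM)
    also have "\<dots> \<le> 2 * t * t" using card_Z by simp
    finally show "card (\<Union>z\<in>Z. out z \<inter> M) \<le> 2 * t * t" .
  qed
  finally have "m \<le> card G + 1 + S + 2 * t * t" by (simp add: S_def)
  then have "m \<le> 2 + 2 * S + 4 * t * t" using G1 by linarith
  \<comment> \<open>This makes \<open>S\<close> linear in \<open>t\<close>. The quadratic bound
    \<open>S_le2\<close> would only give about 18 t^2 for 4 m, too weak against the 17 t^2 of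
    \<open>m_ge\<close>.\<close>
  moreover have "2 * S + 2 * t + 4 \<le> 7 * t + 7" using S_le_digons[OF strong] L_le_crude by linarith
  ultimately have "m \<le> 4 * t * t + 5 * t + 5" by linarith
  from of_nat_mono[OF this, where 'a = real]
  have "real m \<le> 4 * (real t)\<^sup>2 + 5 * real t + 5" by (simp add: power2_eq_square)
  moreover have "(real t)\<^sup>2 \<ge> 0" "real t \<ge> 0" by auto
  ultimately show False using m_ge by linarith
qed

end

section \<open>The upper bound for arbitrary digraphs\<close>

lemma mult_antimono_spread:
  fixes a b c d :: nat
  assumes "a + b = c + d" "b \<le> a" "a \<le> c"
  shows "c * d \<le> a * b"
proof -
  obtain x where c: "c = a + x" using assms(3) le_Suc_ex by blast
  then have "b = d + x" using assms(1) by simp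
  then show ?thesis using c assms(2) by (simp add: algebra_simps)
qed

lemma max_out_not_dense:
  assumes "max_out V A t n u" and "n = a + b" "a \<le> b + t + 1" "b + t \<le> a"
    and e: "a * b + t * n + 2 \<le> card A" and big: "n + t \<le> 2 * card (A `` {u})"
  shows False
proof -
  interpret max_out V A t n u by fact
  \<comment> \<open>\<open>2 * a\<close> exceeds \<open>n + t\<close> by at most 1, so integrality
    gives the claim. Then \<Delta> and \<open>m\<close> are spread at least as far apart as
    \<open>a\<close> and \<open>b\<close>, and their product is at most
    \<open>a * b\<close>.\<close>
  have "a \<le> card (A `` {u})" using assms(2-4) big by linarith
  then have "card (A `` {u}) * card (V - A `` {u}) \<le> a * b"
    using assms m_plus by (intro mult_antimono_spread) auto
  then show False using not_too_dense e by (simp add: mult.commute)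
qed

text \<open>The hypotheses \<open>ab\<close> determine \<open>a\<close> and \<open>b\<close> as the
  rounded halves of n + t and n - t. Since a - b is at most t + 1, an arc count above the bound
  yields \<open>dense\<close>.\<close>

lemma arcs_upper_bound:
  fixes V :: "'a set"
  assumes fin: "finite V" "card V = n" and dg: "is_digraph V A" and fr: "Pk2_free (t + 1) A"
    and t: "t \<ge> 2" and n: "17 * t\<^sup>2 + 60 * t + 54 \<le> 2 * n"
    and ab: "n = a + b" "a \<le> b + t + 1" "b + t \<le> a"
  shows "card A \<le> a * b + t * n + 1"
proof (rule ccontr)
  assume "\<not> ?thesis"
  then have e: "a * b + t * n + 2 \<le> card A" by simp
  have sub: "A \<subseteq> V \<times> V" and irr: "(v, v) \<notin> A" for v using dg by (auto simp: is_digraph_def)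
  then have finA: "finite A" using fin finite_subset by blast
  have free: "card (A `` {x} \<inter> A\<inverse> `` {w}) \<le> t" if "x \<noteq> w" for x w
  proof -
    have "A `` {x} \<inter> A\<inverse> `` {w} = {y. (x, y) \<in> A \<and> (y, w) \<in> A}" by auto
    then show ?thesis using free_card_le[OF finA dg _ that, of t] fr by simp
  qed
  have "n\<^sup>2 \<le> 4 * (a * b) + (t + 1)\<^sup>2"
  proof -
    obtain x where x: "a = b + x" using ab(3) by (metis add.assoc le_Suc_ex)
    then have "x\<^sup>2 \<le> (t + 1)\<^sup>2" using ab(2) by (intro power_mono) auto
    then show ?thesis using x ab(1) by (simp add: power2_eq_square algebra_simps)
  qed
  then have dense: "n\<^sup>2 + 4 * t * n + 8 \<le> 4 * card A + (t + 1)\<^sup>2" using e by simp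
  have "V \<noteq> {}" using fin n by auto
  obtain u where u: "u \<in> V" "\<And>v. v \<in> V \<Longrightarrow> card (A `` {v}) \<le> card (A `` {u})"
    using finite_ne_max[OF fin(1) \<open>V \<noteq> {}\<close>, of "\<lambda>v. card (A `` {v})"] by auto
  obtain w where w: "w \<in> V" "\<And>v. v \<in> V \<Longrightarrow> card (A\<inverse> `` {v}) \<le> card (A\<inverse> `` {w})"
    using finite_ne_max[OF fin(1) \<open>V \<noteq> {}\<close>, of "\<lambda>v. card (A\<inverse> `` {v})"] by auto
  have mo: "max_out V A t n u"
    using fin sub irr free t n dense u by unfold_locales auto
  have mi: "max_out V (A\<inverse>) t n w"
  proof
    show "card (A\<inverse> `` {x} \<inter> (A\<inverse>)\<inverse> `` {y}) \<le> t" if "x \<noteq> y" for x y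
      using free[of y x] that by (simp add: Int_commute)
  qed (use fin sub irr t n dense w in \<open>auto simp: card_inverse\<close>)
  obtain z where z: "z \<in> V" "n + t \<le> card (A\<inverse> `` {z}) + card (A `` {u})"
    using max_out.ex_large_indegree[OF mo] by auto
  show False
  proof (cases "n + t \<le> 2 * card (A `` {u})")
    case True
    then show False using max_out_not_dense[OF mo ab e] by simp
  next
    case False
    then have "n + t \<le> 2 * card (A\<inverse> `` {w})" using z w(2)[OF z(1)] by linarith
    then show False using max_out_not_dense[OF mi ab] e by (simp add: card_inverse)
  qed
qed

subsection \<open>Lower bound\<close>

lemma Pk2_freeI:
  assumes "finite A" "\<And>u w. u \<noteq> w \<Longrightarrow> card {x. (u, x) \<in> A \<and> (x, w) \<in> A} \<le> t"
  shows "Pk2_free (t + 1) A"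
  unfolding Pk2_free_def contains_Pk2_def
proof (clarify)
  fix u w X
  assume X: "u \<noteq> w" "card X = t + 1" "\<forall>x\<in>X. (u, x) \<in> A \<and> (x, w) \<in> A"
  have "finite {x. (u, x) \<in> A \<and> (x, w) \<in> A}"
    using assms(1) by (rule_tac finite_subset[of _ "snd ` A"]) force+
  then have "card X \<le> card {x. (u, x) \<in> A \<and> (x, w) \<in> A}"
    using X(3) by (intro card_mono) auto
  then show False using assms(2)[OF X(1)] X(2) by simp
qed

text \<open>Lets the construction live on a datatype of named vertices, although
  \<open>ex_Pk2\<close> ranges over digraphs on natural numbers.\<close>

lemma Pk2_free_transfer:
  assumes V: "finite V" "card V = n" and dg: "is_digraph V A"
    and free: "\<And>u w. u \<noteq> w \<Longrightarrow> card {x. (u, x) \<in> A \<and> (x, w) \<in> A} \<le> t"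
  obtains B :: "(nat \<times> nat) set"
  where "is_digraph {0..<n} B" "Pk2_free (t + 1) B" "card B = card A"
proof -
  obtain h where h: "bij_betw h V {0..<n}"
    using ex_bij_betw_finite_nat[OF V(1)] V(2) by auto
  then have inj: "inj_on h V" and img: "h ` V = {0..<n}" by (auto simp: bij_betw_def)
  have sub: "A \<subseteq> V \<times> V" and irr: "\<And>v. (v, v) \<notin> A" using dg by (auto simp: is_digraph_def)
  define B where "B = map_prod h h ` A"
  have "card B = card A"
    unfolding B_def by (rule card_image[OF inj_on_subset[OF map_prod_inj_on[OF inj inj] sub]])
  moreover have "is_digraph {0..<n} B"
    unfolding is_digraph_def
  proof (intro conjI allI notI)
    show "B \<subseteq> {0..<n} \<times> {0..<n}" using sub img unfolding B_def by fastforce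
    fix v assume "(v, v) \<in> B"
    then obtain x y where "(x, y) \<in> A" "h x = h y" unfolding B_def by auto
    then show False using sub irr inj by (metis (no_types, lifting) inj_onD mem_Sigma_iff subsetD)
  qed
  moreover have "Pk2_free (t + 1) B"
  proof (rule Pk2_freeI)
    show "finite B" using V sub finite_subset unfolding B_def by blast
    fix u w :: nat assume "u \<noteq> w"
    show "card {x. (u, x) \<in> B \<and> (x, w) \<in> B} \<le> t"
    proof (cases "u \<in> h ` V \<and> w \<in> h ` V")
      case True
      then obtain u' w' where u': "u' \<in> V" "u = h u'" "w' \<in> V" "w = h w'" by auto
      have "{x. (u, x) \<in> B \<and> (x, w) \<in> B} \<subseteq> h ` {x. (u', x) \<in> A \<and> (x, w') \<in> A}"
      proof
        fix x assume "x \<in> {x. (u, x) \<in> B \<and> (x, w) \<in> B}"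
        then obtain a b c d where abcd: "(a, b) \<in> A" "(c, d) \<in> A" "h a = h u'" "h b = x" "h c = x" "h d = h w'"
          using u' unfolding B_def by auto
        then have "{a, b, c, d} \<subseteq> V" using sub by auto
        then have "a = u'" "d = w'" "b = c" using u' abcd inj_on_eq_iff[OF inj] by auto
        with abcd show "x \<in> h ` {x. (u', x) \<in> A \<and> (x, w') \<in> A}" by auto
      qed
      moreover have "finite {x. (u', x) \<in> A \<and> (x, w') \<in> A}"
        using V sub by (rule_tac finite_subset[of _ V]) auto
      ultimately have "card {x. (u, x) \<in> B \<and> (x, w) \<in> B} \<le> card {x. (u', x) \<in> A \<and> (x, w') \<in> A}"
        by (rule surj_card_le[rotated])
      then show ?thesis using free[of u' w'] u' \<open>u \<noteq> w\<close> by fastforce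
    next
      case False
      then have "{x. (u, x) \<in> B \<and> (x, w) \<in> B} = {}" using sub unfolding B_def by auto
      then show ?thesis by (metis card.empty le0)
    qed
  qed
  ultimately show ?thesis using that by blast
qed

text \<open>The involution pairing \<open>2 i\<close> with \<open>2 i + 1\<close>; for odd \<open>m\<close> the leftover \<open>m - 1\<close> is sent to \<open>1\<close>.\<close>
definition mate :: "nat \<Rightarrow> nat \<Rightarrow> nat" where
  "mate m i = (if odd i then i - 1 else if i + 1 < m then i + 1 else 1)"

lemma mate_less: "i < m \<Longrightarrow> 2 \<le> m \<Longrightarrow> mate m i < m"
  by (auto simp: mate_def)

lemma mate_neq: "i < m \<Longrightarrow> 2 \<le> m \<Longrightarrow> mate m i \<noteq> i"
  by (auto simp: mate_def elim!: oddE)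

text \<open>The only failure is the leftover: m - 1 goes to 1 and then to 0. So every surplus path
  involves index 0, which is where \<open>backarc\<close> has to be short.\<close>

lemma mate_mate: "i < m \<Longrightarrow> 2 \<le> m \<Longrightarrow> mate m (mate m i) \<noteq> i \<Longrightarrow> mate m (mate m i) = 0 \<and> odd m"
  by (auto simp: mate_def elim!: oddE evenE split: if_splits)

lemma mate_preimage: "x < m \<Longrightarrow> 2 \<le> m \<Longrightarrow> x = mate m (mate m x) \<or> x = m - 1 \<and> mate m x = 1 \<and> odd m"
  by (auto simp: mate_def elim!: oddE evenE split: if_splits)

lemma mate_neq_last: "odd m \<Longrightarrow> 3 \<le> m \<Longrightarrow> x < m \<Longrightarrow> mate m x \<noteq> m - 1"
  unfolding mate_def by presburger

section \<open>The extremal digraph\<close>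

datatype vert = Core nat | Src nat | Snk nat

text \<open>A circulant bipartite graph. For odd \<open>k\<close> the corner is removed: the vertices without a
  partner already create one path too many from sink \<open>0\<close> or to source \<open>0\<close>.\<close>
definition backarc :: "nat \<Rightarrow> nat \<Rightarrow> nat \<Rightarrow> nat \<Rightarrow> nat \<Rightarrow> bool" where
  "backarc t a k j i \<longleftrightarrow> j < k \<and> i < a \<and> (j \<le> i \<and> i < j + t \<or> i + a < j + t) \<and> \<not> (odd k \<and> j = 0 \<and> i = 0)"

text \<open>Each source has one out-arc among the sources and each sink one in-arc among the sinks.
  A source reaches a sink through the t - 2 core vertices 2, ..., t - 1, through its own mate and
  through the mate of the sink: exactly \<open>t\<close> paths.\<close>

fun arc :: "nat \<Rightarrow> nat \<Rightarrow> nat \<Rightarrow> vert \<Rightarrow> vert \<Rightarrow> bool" where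
  "arc t a k (Core i) (Core j) \<longleftrightarrow> i \<noteq> j \<and> i < t + 2 \<and> j < t + 2"
| "arc t a k (Core i) (Src j) \<longleftrightarrow> False"
| "arc t a k (Core i) (Snk j) \<longleftrightarrow> i < t \<and> j < k"
| "arc t a k (Src i) (Core j) \<longleftrightarrow> i < a \<and> 2 \<le> j \<and> j < t + 2"
| "arc t a k (Src i) (Src j) \<longleftrightarrow> i < a \<and> j = mate a i"
| "arc t a k (Src i) (Snk j) \<longleftrightarrow> i < a \<and> j < k"
| "arc t a k (Snk i) (Core j) \<longleftrightarrow> False"
| "arc t a k (Snk i) (Src j) \<longleftrightarrow> backarc t a k i j"
| "arc t a k (Snk i) (Snk j) \<longleftrightarrow> j < k \<and> i = mate k j"

context
  fixes t a k :: nat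
  assumes t: "2 \<le> t" and kt: "t + 2 \<le> k" and ak: "a = k \<or> a = k + 1"
begin

lemma ka: "k \<le> a" "t + 2 \<le> a" using ak kt by auto

lemma row_eq: "{i. backarc t a k j i} = {j..<min a (j + t)} \<union> {..<j + t - a} - (if odd k \<and> j = 0 then {0} else {})"
  if "j < k"
  using that ka unfolding backarc_def by auto

lemma card_row_full: "card ({j..<min a (j + t)} \<union> {..<j + t - a}) = t" if "j < k"
  using that ka by (subst card_Un_disjoint) auto

lemma card_row: "card {i. backarc t a k j i} = (if odd k \<and> j = 0 then t - 1 else t)" if "j < k"
  using card_row_full[OF that] that ka t unfolding row_eq[OF that] by (auto simp: card_Diff_singleton_if)

lemma fin_row: "finite {i. backarc t a k j i}"
  by (rule finite_subset[of _ "{..<a}"]) (auto simp: backarc_def)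
lemma fin_col: "finite {j. backarc t a k j i}"
  by (rule finite_subset[of _ "{..<k}"]) (auto simp: backarc_def)

lemma card_row_le: "card {i. backarc t a k j i} \<le> t"
proof (cases "j < k")
  case False
  then have "{i. backarc t a k j i} = {}" by (auto simp: backarc_def)
  then show ?thesis by simp
qed (simp add: card_row)

lemma card_row_0: "odd k \<Longrightarrow> card {i. backarc t a k 0 i} \<le> t - 1"
  using card_row[of 0] kt by simp

lemma card_col_le: "card {j. backarc t a k j i} \<le> t"
proof -
  have "card {j. backarc t a k j i} \<le> card ({i + 1 - t..<i + 1} \<union> {i + a + 1 - t..<k})"
    by (intro card_mono) (auto simp: backarc_def)
  also have "\<dots> \<le> card {i + 1 - t..<i + 1} + card {i + a + 1 - t..<k}" by (rule card_Un_le)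
  also have "\<dots> \<le> t" using ka by simp
  finally show ?thesis .
qed

text \<open>For odd \<open>k\<close> the corner is missing. If only \<open>a\<close> is odd, then a
  = k + 1, and the cyclic window through source 0 loses the nonexistent sink
  \<open>k\<close>.\<close>

lemma card_col_0: "odd a \<or> odd k \<Longrightarrow> card {j. backarc t a k j 0} \<le> t - 1"
proof -
  assume odd: "odd a \<or> odd k"
  have "card {j. backarc t a k j 0} \<le> card ((if odd k then {} else {0}) \<union> {a + 1 - t..<k})"
    by (intro card_mono) (auto simp: backarc_def)
  also have "\<dots> \<le> card (if odd k then {} else {0::nat}) + card {a + 1 - t..<k}" by (rule card_Un_le)
  also have "\<dots> \<le> t - 1" using ak odd kt t by auto
  finally show ?thesis .
qed

text \<open>Either set has two elements only when the leftover and 0 share the mate 1. This is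
  harmless for t \<ge> 4; smaller \<open>t\<close> needs the position of the windows.\<close>

lemma paths_Snk_Src:
  "card {x. backarc t a k i x \<and> x < a \<and> j = mate a x} + card {q. q < k \<and> i = mate k q \<and> backarc t a k q j} \<le> t"
proof -
  let ?X = "{x. backarc t a k i x \<and> x < a \<and> j = mate a x}"
  let ?Y = "{q. q < k \<and> i = mate k q \<and> backarc t a k q j}"
  have X: "?X \<subseteq> {mate a j, a - 1}" using mate_preimage[of _ a] ka t by auto
  have Y: "?Y \<subseteq> {mate k i, k - 1}" using mate_preimage[of _ k] kt by auto
  have X2: "card ?X \<le> 2" using card_mono[OF _ X] by (simp add: card_insert_if split: if_splits)
  have Y2: "card ?Y \<le> 2" using card_mono[OF _ Y] by (simp add: card_insert_if split: if_splits)
  have XX: "card ?X \<le> 1 \<or> backarc t a k i 0 \<and> backarc t a k i (a - 1) \<and> odd a"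
  proof (cases "odd a \<and> j = 1")
    case True
    then have "mate a j = 0" by (simp add: mate_def)
    then have "card ?X \<le> card ({x \<in> {0, a - 1}. backarc t a k i x})"
      using X by (intro card_mono) auto
    moreover have "card {x \<in> {0, a - 1}. backarc t a k i x} \<le> 1" if "\<not> (backarc t a k i 0 \<and> backarc t a k i (a - 1))"
    proof -
      have "{x \<in> {0, a - 1}. backarc t a k i x} \<subseteq> (if backarc t a k i 0 then {0} else {a - 1})" using that by auto
      then have "card {x \<in> {0, a - 1}. backarc t a k i x} \<le> card (if backarc t a k i 0 then {0} else {a - 1})"
        by (intro card_mono) auto
      then show ?thesis by (simp split: if_splits)
    qed
    ultimately show ?thesis using True by fastforce
  next
    case False
    then have "?X \<subseteq> {mate a j}" using mate_preimage[of _ a] ka t by auto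
    then show ?thesis using card_mono[of "{mate a j}" ?X] by simp
  qed
  have YY: "card ?Y \<le> 1 \<or> i = 1 \<and> backarc t a k 0 j \<and> backarc t a k (k - 1) j \<and> odd k"
  proof (cases "odd k \<and> i = 1")
    case True
    then have "mate k i = 0" by (simp add: mate_def)
    then have "card ?Y \<le> card ({q \<in> {0, k - 1}. backarc t a k q j})"
      using Y by (intro card_mono) auto
    moreover have "card {q \<in> {0, k - 1}. backarc t a k q j} \<le> 1" if "\<not> (backarc t a k 0 j \<and> backarc t a k (k - 1) j)"
    proof -
      have "{q \<in> {0, k - 1}. backarc t a k q j} \<subseteq> (if backarc t a k 0 j then {0} else {k - 1})" using that by auto
      then have "card {q \<in> {0, k - 1}. backarc t a k q j} \<le> card (if backarc t a k 0 j then {0} else {k - 1})"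
        by (intro card_mono) auto
      then show ?thesis by (simp split: if_splits)
    qed
    ultimately show ?thesis using True by fastforce
  next
    case False
    then have "?Y \<subseteq> {mate k i}" using mate_preimage[of _ k] kt by auto
    then show ?thesis using card_mono[of "{mate k i}" ?Y] by simp
  qed
  \<comment> \<open>A window of length 2 containing 0 and a - 1 wraps around, so \<open>i\<close> is
    the leftover sink, which is nobody's mate.\<close>
  have YE: "?Y = {}" if "t = 2" "backarc t a k i 0" "backarc t a k i (a - 1)" "odd a"
  proof -
    have "i = k - 1" "a = k" using that ka ak kt by (auto simp: backarc_def)
    then have "mate k q \<noteq> i" if "q < k" for q
      using mate_neq_last[of k q] \<open>odd a\<close> that kt t by simp
    then show ?thesis by blast
  qed
  \<comment> \<open>The windows of sinks 0 and k - 1 could share only source 0, but odd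
    \<open>k\<close> removes the corner.\<close>
  have no2: False if "t = 2" "backarc t a k 0 j" "backarc t a k (k - 1) j" "odd k"
    using that ka ak kt by (auto simp: backarc_def)
  have no3: False if "t \<le> 3" "i = 1" "backarc t a k i 0"
    using that ka ak kt t by (auto simp: backarc_def)
  consider "t = 2" | "t = 3" | "t \<ge> 4" using t by linarith
  then show ?thesis
  proof cases
    case 1
    show ?thesis
    proof (cases "card ?X \<le> 1")
      case True
      moreover have "card ?Y \<le> 1" using YY no2 1 by blast
      ultimately show ?thesis using t by linarith
    next
      case False
      then have "?Y = {}" using XX YE 1 by blast
      then have "card ?Y = 0" by (metis card.empty)
      then show ?thesis using X2 t by linarith
    qed
  next
    case 2
    then have "card ?X \<le> 1 \<or> card ?Y \<le> 1" using XX YY no3 by (metis order_refl)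
    then show ?thesis using X2 Y2 2 by linarith
  next
    case 3
    then show ?thesis using X2 Y2 by linarith
  qed
qed

section \<open>Freeness and size of the extremal digraph\<close>

definition "ext_arcs = {(x, y). arc t a k x y}"
definition "ext_verts = Core ` {..<t + 2} \<union> Src ` {..<a} \<union> Snk ` {..<k}"

lemma card_ext_verts: "card ext_verts = t + 2 + a + k"
  unfolding ext_verts_def by (subst card_Un_disjoint card_image; auto simp: card_image inj_on_def)+

lemma ext_arcs_digraph: "is_digraph ext_verts ext_arcs"
  unfolding is_digraph_def
proof (intro conjI allI)
  have "x \<in> ext_verts \<and> y \<in> ext_verts" if "arc t a k x y" for x y
    using that kt ka mate_less[of _ a] mate_less[of _ k]
    by (cases x; cases y) (auto simp: ext_verts_def backarc_def)
  then show "ext_arcs \<subseteq> ext_verts \<times> ext_verts" by (auto simp: ext_arcs_def)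
  have "i < a \<Longrightarrow> i = mate a i \<longleftrightarrow> False" "i < k \<Longrightarrow> i = mate k i \<longleftrightarrow> False" for i
    using mate_neq[of i a] mate_neq[of i k] kt ka by auto
  then show "(v, v) \<notin> ext_arcs" for v by (cases v) (auto simp: ext_arcs_def)
qed

lemma finite_ext_verts: "finite ext_verts" by (simp add: ext_verts_def)

lemma ext_arcs_free:
  assumes "u \<noteq> w"
  shows "card {x. (u, x) \<in> ext_arcs \<and> (x, w) \<in> ext_arcs} \<le> t"
proof -
  define X where "X = {c. arc t a k u (Core c) \<and> arc t a k (Core c) w}"
  define Y where "Y = {c. arc t a k u (Src c) \<and> arc t a k (Src c) w}"
  define Z where "Z = {c. arc t a k u (Snk c) \<and> arc t a k (Snk c) w}"
  have eq: "{x. (u, x) \<in> ext_arcs \<and> (x, w) \<in> ext_arcs} = Core ` X \<union> Src ` Y \<union> Snk ` Z"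
  proof (intro set_eqI)
    fix x show "x \<in> {x. (u, x) \<in> ext_arcs \<and> (x, w) \<in> ext_arcs} \<longleftrightarrow> x \<in> Core ` X \<union> Src ` Y \<union> Snk ` Z"
      by (cases x) (auto simp: ext_arcs_def X_def Y_def Z_def)
  qed
  have "card {x. (u, x) \<in> ext_arcs \<and> (x, w) \<in> ext_arcs} \<le> card (Core ` X) + card (Src ` Y) + card (Snk ` Z)"
    unfolding eq by (intro order_trans[OF card_Un_le] add_mono) auto
  also have "\<dots> = card X + card Y + card Z" by (simp add: card_image inj_on_def)
  finally have le: "card {x. (u, x) \<in> ext_arcs \<and> (x, w) \<in> ext_arcs} \<le> card X + card Y + card Z" .
  have "card X + card Y + card Z \<le> t"
  proof (cases u; cases w)
    fix i j assume uw: "u = Core i" "w = Core j"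
    then have "Y = {}" "Z = {}" by (auto simp: Y_def Z_def)
    moreover have "card X \<le> t"
    proof (cases "i < t + 2 \<and> j < t + 2")
      case True
      have "card X \<le> card ({..<t + 2} - {i, j})" using uw by (intro card_mono) (auto simp: X_def)
      then show ?thesis using True uw assms by (subst (asm) card_Diff_subset) auto
    next
      case False
      then have "X = {}" using uw by (auto simp: X_def)
      then show ?thesis by simp
    qed
    ultimately show ?thesis by simp
  next
    fix i j assume uw: "u = Core i" "w = Src j"
    then have "X = {}" "Y = {}" by (auto simp: X_def Y_def)
    moreover have "card Z \<le> card {q. backarc t a k q j}" using uw fin_col by (intro card_mono) (auto simp: Z_def)
    ultimately show ?thesis using card_col_le[of j] by simp
  next
    fix i j assume uw: "u = Core i" "w = Snk j"
    then have "Y = {}" by (auto simp: Y_def)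
    \<comment> \<open>A core vertex that itself dominates the sinks is no middle vertex, which makes
      room for the path through the mate of the sink.\<close>
    moreover have "card X \<le> card ({..<t} - {i})" using uw by (intro card_mono) (auto simp: X_def)
    moreover have "card Z \<le> card (if i < t then {mate k j} else {})"
      using uw by (intro card_mono) (auto simp: Z_def)
    ultimately show ?thesis using t by (cases "i < t") (auto simp: card_Diff_singleton_if)
  next
    fix i j assume uw: "u = Src i" "w = Core j"
    then have "Z = {}" by (auto simp: Z_def)
    moreover have "card X \<le> card ({2..<t + 2} - {j})" using uw by (intro card_mono) (auto simp: X_def)
    moreover have "card Y \<le> card (if 2 \<le> j \<and> j < t + 2 then {mate a i} else {})"
      using uw by (intro card_mono) (auto simp: Y_def)
    ultimately show ?thesis using t by (cases "2 \<le> j \<and> j < t + 2") (auto simp: card_Diff_singleton_if)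
  next
    fix i j assume uw: "u = Src i" "w = Src j"
    then have "X = {}" by (auto simp: X_def)
    have Z: "card Z \<le> card {q. backarc t a k q j}" using uw fin_col by (intro card_mono) (auto simp: Z_def)
    have "Y \<subseteq> {mate a i}" using uw by (auto simp: Y_def)
    then have Y1: "card Y \<le> 1" using card_mono[of "{mate a i}" Y] by simp
    show ?thesis
    proof (cases "Y = {}")
      case True
      then show ?thesis using \<open>X = {}\<close> Z card_col_le[of j] by simp
    next
      case False
      then have "i < a" "j = mate a (mate a i)" "j \<noteq> i" using uw assms by (auto simp: Y_def)
      \<comment> \<open>The surplus path from the leftover source ends in source 0, whose column is
        one short.\<close>
      then have "j = 0" "odd a" using mate_mate[of i a] ka t by auto
      then have "card Z \<le> t - 1" using Z card_col_0 by simp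
      then show ?thesis using Y1 t \<open>X = {}\<close> by simp
    qed
  next
    fix i j assume uw: "u = Src i" "w = Snk j"
    have "card X \<le> card {2..<t}" using uw by (intro card_mono) (auto simp: X_def)
    moreover have "card Y \<le> card {mate a i}" using uw by (intro card_mono) (auto simp: Y_def)
    moreover have "card Z \<le> card {mate k j}" using uw by (intro card_mono) (auto simp: Z_def)
    ultimately show ?thesis using t by simp
  next
    fix i j assume uw: "u = Snk i" "w = Core j"
    then have "X = {}" "Z = {}" by (auto simp: X_def Z_def)
    moreover have "card Y \<le> card {x. backarc t a k i x}" using uw fin_row by (intro card_mono) (auto simp: Y_def)
    ultimately show ?thesis using card_row_le[of i] by simp
  next
    fix i j assume uw: "u = Snk i" "w = Src j"
    then have "X = {}" by (auto simp: X_def)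
    moreover have "Y = {x. backarc t a k i x \<and> x < a \<and> j = mate a x}" using uw by (auto simp: Y_def)
    moreover have "Z = {q. q < k \<and> i = mate k q \<and> backarc t a k q j}" using uw by (auto simp: Z_def)
    ultimately show ?thesis using paths_Snk_Src[of i j] by simp
  next
    fix i j assume uw: "u = Snk i" "w = Snk j"
    then have "X = {}" by (auto simp: X_def)
    have Y: "card Y \<le> card {x. backarc t a k i x}" using uw fin_row by (intro card_mono) (auto simp: Y_def)
    have "Z \<subseteq> {mate k j}" using uw by (auto simp: Z_def)
    then have Z1: "card Z \<le> 1" using card_mono[of "{mate k j}" Z] by simp
    show ?thesis
    proof (cases "Z = {}")
      case True
      then show ?thesis using \<open>X = {}\<close> Y card_row_le[of i] by simp
    next
      case False
      then have "j < k" "i = mate k (mate k j)" "j \<noteq> i" using uw assms by (auto simp: Z_def)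
      then have "i = 0" "odd k" using mate_mate[of j k] kt by auto
      then have "card Y \<le> t - 1" using Y card_row_0 by simp
      then show ?thesis using Z1 t \<open>X = {}\<close> by simp
    qed
  qed
  then show ?thesis using le by linarith
qed

lemma card_backarc: "card {(j, i). backarc t a k j i} + of_bool (odd k) = k * t"
proof -
  have "{(j, i). backarc t a k j i} = Sigma {..<k} (\<lambda>j. {i. backarc t a k j i})" by (auto simp: backarc_def)
  then have "card {(j, i). backarc t a k j i} = (\<Sum>j<k. if odd k \<and> j = 0 then t - 1 else t)"
    by (simp add: card_SigmaI fin_row card_row)
  also have "\<dots> + of_bool (odd k) = k * t"
  proof -
    obtain k' where "k = Suc k'" using kt by (cases k) auto
    then show ?thesis using t by (simp add: sum.lessThan_Suc_shift del: sum.lessThan_Suc)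
  qed
  finally show ?thesis .
qed

lemma card_ext_arcs: "card ext_arcs + of_bool (odd k) = (t + 2) * (t + 1) + t * k + a * t + a + a * k + k * t + k"
proof -
  define f where "f = map_prod Core Core ` (Sigma {..<t + 2} (\<lambda>i. {..<t + 2} - {i}))"
  define g where "g = map_prod Core Snk ` ({..<t} \<times> {..<k})"
  define h where "h = map_prod Src Core ` ({..<a} \<times> {2..<t + 2})"
  define p where "p = (\<lambda>i. (Src i, Src (mate a i))) ` {..<a}"
  define q where "q = map_prod Src Snk ` ({..<a} \<times> {..<k})"
  define r where "r = map_prod Snk Src ` {(j, i). backarc t a k j i}"
  define s where "s = (\<lambda>j. (Snk (mate k j), Snk j)) ` {..<k}"
  have eq: "ext_arcs = f \<union> (g \<union> (h \<union> (p \<union> (q \<union> (r \<union> s)))))"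
  proof (intro set_eqI)
    fix e :: "vert \<times> vert"
    obtain x y where e: "e = (x, y)" by (cases e)
    show "e \<in> ext_arcs \<longleftrightarrow> e \<in> f \<union> (g \<union> (h \<union> (p \<union> (q \<union> (r \<union> s)))))"
      unfolding e ext_arcs_def f_def g_def h_def p_def q_def r_def s_def
      by (cases x; cases y) (auto simp: map_prod_def image_iff)
  qed
  have finb: "finite {(j, i). backarc t a k j i}"
    by (rule finite_subset[of _ "{..<k} \<times> {..<a}"]) (auto simp: backarc_def)
  have fin: "finite f" "finite g" "finite h" "finite p" "finite q" "finite r" "finite s"
    using finb by (auto simp: f_def g_def h_def p_def q_def r_def s_def)
  have "card f = (t + 2) * (t + 1)"
    unfolding f_def by (subst card_image) (auto simp: inj_on_def card_SigmaI)
  moreover have "card g = t * k" unfolding g_def by (subst card_image) (auto simp: inj_on_def)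
  moreover have "card h = a * t" unfolding h_def by (subst card_image) (auto simp: inj_on_def)
  moreover have "card p = a" unfolding p_def by (subst card_image) (auto simp: inj_on_def)
  moreover have "card q = a * k" unfolding q_def by (subst card_image) (auto simp: inj_on_def)
  moreover have "card r = card {(j, i). backarc t a k j i}"
    unfolding r_def by (subst card_image) (auto simp: inj_on_def)
  moreover have "card s = k" unfolding s_def by (subst card_image) (auto simp: inj_on_def)
  moreover have "card ext_arcs = card f + (card g + (card h + (card p + (card q + (card r + card s)))))"
    unfolding eq using fin
    by (subst card_Un_disjoint; auto simp: f_def g_def h_def p_def q_def r_def s_def)+
  ultimately show ?thesis using card_backarc by linarith
qed

end

lemma ex_Pk2_eqI:
  fixes n t g :: nat
  assumes ub: "\<And>A :: (nat \<times> nat) set. is_digraph {0..<n} A \<Longrightarrow> Pk2_free (t + 1) A \<Longrightarrow> card A \<le> g"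
    and ex: "is_digraph {0..<n} B" "Pk2_free (t + 1) B" "h \<le> card B"
  shows "h \<le> ex_Pk2 n (t + 1)" "ex_Pk2 n (t + 1) \<le> g"
proof -
  let ?S = "{card A | A :: (nat \<times> nat) set. is_digraph {0..<n} A \<and> Pk2_free (t + 1) A}"
  have fin: "finite ?S" by (rule finite_subset[of _ "{..g}"]) (use ub in auto)
  have B: "card B \<in> ?S" using ex by blast
  then show "h \<le> ex_Pk2 n (t + 1)"
    unfolding ex_Pk2_def using ex(3) Max_ge[OF fin B] by linarith
  have "Max ?S \<in> ?S" using fin B by (intro Max_in) auto
  then show "ex_Pk2 n (t + 1) \<le> g" unfolding ex_Pk2_def using ub by auto
qed

lemma arcs_lower_bound:
  fixes a b t n :: nat
  assumes t: "2 \<le> t" and ab: "n = a + b" "a \<le> b + t + 1" "b + t \<le> a" and b: "t + 3 \<le> b"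
  obtains B :: "(nat \<times> nat) set"
  where "is_digraph {0..<n} B" "Pk2_free (t + 1) B" "card B + of_bool (even b) = a * b + t * n + 1"
proof -
  \<comment> \<open>Of the \<open>t + 2\<close> core vertices, \<open>t + 1\<close> are charged to
    \<open>a\<close> and one to \<open>b\<close>. The remaining parts differ by at most 1, and
    \<open>k\<close> is odd exactly when \<open>b\<close> is even.\<close>
  define k where "k = b - 1"
  define c where "c = a - t - 1"
  have bk: "b = k + 1" and ac: "a = c + t + 1" using b ab by (auto simp: k_def c_def)
  have c: "2 \<le> t" "t + 2 \<le> k" "c = k \<or> c = k + 1" using t b ab bk ac by auto
  have "card (ext_verts t c k) = n" using card_ext_verts[OF c] ab bk ac by simp
  from Pk2_free_transfer[OF finite_ext_verts[OF c] this ext_arcs_digraph[OF c] ext_arcs_free[OF c]]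
  obtain B :: "(nat \<times> nat) set" where B: "is_digraph {0..<n} B" "Pk2_free (t + 1) B" "card B = card (ext_arcs t c k)"
    by metis
  have "card (ext_arcs t c k) + of_bool (odd k) = a * b + t * n + 1"
    using card_ext_arcs[OF c] unfolding ab(1) bk ac by (simp add: algebra_simps)
  then have "card B + of_bool (even b) = a * b + t * n + 1" using B(3) bk by simp
  then show ?thesis using that B by blast
qed

subsection \<open>The extremal number\<close>

lemma ceiling_half: "nat \<lceil>real m / 2\<rceil> = (m + 1) div 2"
proof -
  have "m = 2 * ((m + 1) div 2) \<or> m + 1 = 2 * ((m + 1) div 2)" by presburger
  then have "\<lceil>real m / 2\<rceil> = int ((m + 1) div 2)"
    unfolding ceiling_eq_iff by linarith
  then show ?thesis by simp
qed

lemma floor_half: "nat \<lfloor>real m / 2\<rfloor> = m div 2"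
  using floor_divide_of_nat_eq[of m 2, where 'a = real] by simp

theorem theorem1p1:
  fixes n t :: nat
  assumes "t \<ge> 2"
    and "real n \<ge> real (t^3 + 4*t^2 + 3*t + 4)"
    and "real n \<ge> 17/2 * real t ^ 2 + 30 * real t + 27"
  defines "g \<equiv> nat (ceiling ((real n + real t) / 2)) * nat (floor ((real n - real t) / 2)) + t * n + 1"
  shows "(odd (nat (floor ((real n - real t) / 2))) \<longrightarrow> ex_Pk2 n (t + 1) = g)
       \<and> (even (nat (floor ((real n - real t) / 2))) \<longrightarrow> ex_Pk2 n (t + 1) \<in> {g - 1, g})"
proof -
  define a where "a = (n + t + 1) div 2"
  define b where "b = (n - t) div 2"
  have "real (17 * t\<^sup>2 + 60 * t + 54) \<le> real (2 * n)" using assms(3) by simp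
  then have n: "17 * t\<^sup>2 + 60 * t + 54 \<le> 2 * n" by (simp only: of_nat_le_iff)
  then have n': "30 * t + 27 \<le> n" by linarith
  have ab: "n = a + b" "a \<le> b + t + 1" "b + t \<le> a" and bt: "t + 3 \<le> b" and nt: "t \<le> n"
  proof -
    show "t \<le> n" using n' by linarith
    have "n - t = 2 * b \<or> n - t = 2 * b + 1" unfolding b_def by presburger
    then have "n = t + 2 * b \<and> a = b + t \<or> n = t + 2 * b + 1 \<and> a = b + t + 1"
      using \<open>t \<le> n\<close> unfolding a_def by auto
    then show "n = a + b" "a \<le> b + t + 1" "b + t \<le> a" "t + 3 \<le> b" using n' by auto
  qed
  have ca: "nat \<lceil>(real n + real t) / 2\<rceil> = a"
    unfolding a_def using ceiling_half[of "n + t"] by simp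
  have fb: "nat \<lfloor>(real n - real t) / 2\<rfloor> = b"
    unfolding b_def using floor_half[of "n - t"] nt by (simp add: of_nat_diff)
  have g: "g = a * b + t * n + 1" unfolding g_def ca fb ..
  obtain B :: "(nat \<times> nat) set"
    where B: "is_digraph {0..<n} B" "Pk2_free (t + 1) B" "card B + of_bool (even b) = g"
    using arcs_lower_bound[OF assms(1) ab bt] g by metis
  have ub: "card A \<le> g" if "is_digraph {0..<n} A" "Pk2_free (t + 1) A" for A :: "(nat \<times> nat) set"
    unfolding g using that assms(1) n ab by (intro arcs_upper_bound[of "{0..<n}"]) auto
  have "card B \<le> ex_Pk2 n (t + 1)" "ex_Pk2 n (t + 1) \<le> g"
    by (rule ex_Pk2_eqI[OF ub B(1,2) order_refl]; assumption)+
  then show ?thesis unfolding fb using B(3) by (cases "even b") auto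
qed

end
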